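(* Let $\omega\in\mathbb{R}\setminus\{0\}$ be such that all the polynomials $\mathcal{S}_n^\omega$, $n\ge0$, are defined, that is, $\omega\notin\{-1,-2,\ldots\}$. Then $$\sum_{n=0}^\infty\frac{(1+\omega)_n}{n!}\,\mathcal{S}_n^\omega(z)\,T^n=\frac{(1+T)^\omega}{(1-zT)^{\omega+1}},\qquad |zT|<1.$$
   Context: For $n\in\{0,1,2,\ldots\}$ and real $\omega\notin\{-1,\ldots,-n\}$ the skyburst polynomial $\mathcal{S}_n^\omega$ is the monic polynomial of degree $n$ $$\mathcal{S}_n^\omega(z)=z^n\,{}_2F_1\!\left[\begin{array}{l}-n,-\omega;\\-n-\omega;\end{array}-\frac1z\right]=\sum_{\ell=0}^n\binom{n}{\ell}\frac{(-\omega)_\ell}{(-n-\omega)_\ell}\,z^{n-\ell},$$ where $(a)_\ell=a(a+1)\cdots(a+\ell-1)$, $(a)_0=1$.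
   Formalization: Besides |zT|<1, the series must converge: |T|<1, or ω is a positive integer, or |T|=1 with ω>0, or |T|=1 with ω>-1 and T≠-1. As printed it fails: for z=0, ω=1/2, T=2 the left side is the divergent binomial series. *)

theory Defs
  imports "HOL-Analysis.Analysis" "HOL-Computational_Algebra.Polynomial"
begin

text \<open>The formula is meaningful when \<open>\<omega> \<notin> {-1, \<dots>, -n}\<close>; otherwise some denominator vanishes
  and HOL's division by zero makes the corresponding coefficients \<open>0\<close>.\<close>

definition skyburst :: "nat \<Rightarrow> real \<Rightarrow> complex poly" where
  "skyburst n \<omega> = (\<Sum>l\<le>n. monom (complex_of_real
      (real (n choose l) * (pochhammer (- \<omega>) l / pochhammer (- real n - \<omega>) l))) (n - l))"

lemma poly_skyburst:
  "poly (skyburst n \<omega>) z =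
     (\<Sum>l\<le>n. complex_of_real (real (n choose l) *
        (pochhammer (- \<omega>) l / pochhammer (- real n - \<omega>) l)) * z ^ (n - l))"
  by (simp add: skyburst_def poly_sum poly_monom)

lemma skyburst_denominator_nonzero:
  assumes "\<And>k. \<lbrakk>1 \<le> k; k \<le> n\<rbrakk> \<Longrightarrow> \<omega> \<noteq> - real k" and "l \<le> n"
  shows "pochhammer (- real n - \<omega>) l \<noteq> 0"
proof
  assume "pochhammer (- real n - \<omega>) l = 0"
  then obtain k where k: "k < l" "- real n - \<omega> = - real k"
    by (auto simp: pochhammer_eq_0_iff)
  then have "\<omega> = - real (n - k)"
    using assms(2) by (simp add: of_nat_diff)
  moreover have "1 \<le> n - k" "n - k \<le> n" using k(1) assms(2) by auto
  ultimately show False using assms(1) by blast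
qed

lemma coeff_skyburst_top: "coeff (skyburst n \<omega>) n = 1"
proof -
  have "coeff (skyburst n \<omega>) n = (\<Sum>l\<le>n. if l = 0 then 1 else 0)"
    unfolding skyburst_def coeff_sum by (rule sum.cong) auto
  then show ?thesis by simp
qed

lemma degree_skyburst: "degree (skyburst n \<omega>) = n"
proof (rule antisym)
  show "degree (skyburst n \<omega>) \<le> n"
    unfolding skyburst_def
    by (intro degree_sum_le) (auto intro: order_trans[OF degree_monom_le])
  show "n \<le> degree (skyburst n \<omega>)"
    by (intro le_degree) (simp add: coeff_skyburst_top)
qed

lemma lead_coeff_skyburst: "lead_coeff (skyburst n \<omega>) = 1"
  by (simp add: degree_skyburst coeff_skyburst_top)

lemma poly_skyburst_hypergeometric:
  assumes "z \<noteq> 0"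
  shows "poly (skyburst n \<omega>) z =
     z ^ n * (\<Sum>l\<le>n. complex_of_real (pochhammer (- real n) l * pochhammer (- \<omega>) l /
        (pochhammer (- real n - \<omega>) l * fact l)) * (- 1 / z) ^ l)"
proof -
  have ch: "real (n choose l) = (- 1) ^ l * pochhammer (- real n) l / fact l" for l
    by (simp add: binomial_gbinomial gbinomial_pochhammer)
  have pw: "z ^ (n - l) * (- 1) ^ l = z ^ n * (- 1 / z) ^ l" if "l \<le> n" for l
  proof -
    have "z ^ n = z ^ (n - l) * z ^ l" using that by (simp flip: power_add)
    moreover have "z ^ l * (- 1 / z) ^ l = (- 1) ^ l"
      using assms by (simp flip: power_mult_distrib)
    ultimately show ?thesis by (metis mult.assoc)
  qed
  show ?thesis
    unfolding poly_skyburst sum_distrib_left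
  proof (rule sum.cong[OF refl])
    fix l assume "l \<in> {..n}"
    then have "z ^ (n - l) * (- 1) ^ l = z ^ n * (- 1 / z) ^ l" using pw by simp
    moreover have "complex_of_real (real (n choose l) *
        (pochhammer (- \<omega>) l / pochhammer (- real n - \<omega>) l)) * z ^ (n - l) =
      complex_of_real (pochhammer (- real n) l * pochhammer (- \<omega>) l /
        (pochhammer (- real n - \<omega>) l * fact l)) * (z ^ (n - l) * (- 1) ^ l)"
      unfolding ch by (simp add: mult_ac)
    ultimately show "complex_of_real (real (n choose l) *
        (pochhammer (- \<omega>) l / pochhammer (- real n - \<omega>) l)) * z ^ (n - l) =
      z ^ n * (complex_of_real (pochhammer (- real n) l * pochhammer (- \<omega>) l /
        (pochhammer (- real n - \<omega>) l * fact l)) * (- 1 / z) ^ l)"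
      by (simp add: mult_ac)
  qed
qed

end

theory Submission
  imports Defs
begin

text \<open>The coefficient identity \<open>skyburst_coeff\<close> exhibits the series as the Cauchy product of the
  binomial series of \<open>(1 + T)\<^sup>\<omega>\<close> and of \<open>(1 - z T)\<^sup>-\<^sup>\<omega>\<^sup>-\<^sup>1\<close>. The second one converges absolutely, so
  by Mertens' theorem it suffices that the first one converges. On \<open>\<bar>T\<bar> = 1\<close> with \<open>\<omega> > 0\<close> this
  is a dominated limit from inside the disc; for \<open>-1 < \<omega> < 0\<close> multiplying the partial sums
  by \<open>1 + T\<close> turns them into those for \<open>\<omega> + 1\<close> up to a vanishing term.\<close>

section \<open>Cauchy products with one absolutely convergent factor\<close>

theorem Mertens_sums:
  fixes a b :: "nat \<Rightarrow> 'a :: {real_normed_algebra, banach}"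
  assumes a: "a sums A" and b: "summable (\<lambda>k. norm (b k))"
  shows "(\<lambda>n. \<Sum>i\<le>n. a i * b (n - i)) sums (A * suminf b)"
proof -
  define P where "P m = sum a {..<m}" for m
  have P: "P \<longlonglongrightarrow> A" using a unfolding sums_def P_def .
  then obtain C where C: "\<And>m. norm (P m) \<le> C"
    by (meson Bseq_def convergentI convergent_imp_Bseq)
  \<comment> \<open>Grouping the first \<open>N\<close> antidiagonals by the index \<open>k\<close>
    of \<open>b\<close> leaves \<open>P (N - k) * b k\<close> for each \<open>k < N\<close>. Padding
    with zeros turns this sum of varying length into a series over all \<open>k\<close>, the form
    that Tannery's theorem needs.\<close>
  define f where "f k n = (if k < n then P (n - k) * b k else 0)" for k n
  have partial: "(\<Sum>n<N. \<Sum>i\<le>n. a i * b (n - i)) = (\<Sum>k. f k N)" for N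
  proof -
    have "(\<Sum>n<N. \<Sum>i\<le>n. a i * b (n - i)) = (\<Sum>n<N. \<Sum>k\<le>n. a (n - k) * b k)"
    proof (rule sum.cong[OF refl])
      show "(\<Sum>i\<le>n. a i * b (n - i)) = (\<Sum>k\<le>n. a (n - k) * b k)" for n
        by (rule sum.reindex_bij_witness[of _ "\<lambda>k. n - k" "\<lambda>i. n - i"]) auto
    qed
    also have "\<dots> = (\<Sum>(n, k)\<in>(SIGMA n:{..<N}. {..n}). a (n - k) * b k)"
      by (simp add: sum.Sigma)
    also have "\<dots> = (\<Sum>(k, i)\<in>(SIGMA k:{..<N}. {..<N - k}). a i * b k)"
      by (rule sum.reindex_bij_witness[of _ "\<lambda>(k, i). (i + k, k)" "\<lambda>(n, k). (k, n - k)"]) auto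
    also have "\<dots> = (\<Sum>k<N. f k N)"
      by (simp add: sum.Sigma[symmetric] f_def P_def sum_distrib_right)
    also have "\<dots> = (\<Sum>k. f k N)"
      by (rule suminf_finite[symmetric]) (auto simp: f_def)
    finally show ?thesis .
  qed
  \<comment> \<open>Each term tends to \<open>A * b k\<close>, and the bound \<open>C\<close> on the
    convergent partial sums gives the summable majorant \<open>C * norm (b k)\<close>.\<close>
  have "((\<lambda>N. \<Sum>k. f k N) \<longlonglongrightarrow> (\<Sum>k. A * b k))"
  proof (rule tannerys_theorem[where M = "\<lambda>k. C * norm (b k)", THEN conjunct2, THEN conjunct2])
    show "(\<lambda>n. f k n) \<longlonglongrightarrow> A * b k" for k
    proof (rule Lim_transform_eventually)
      have "(\<lambda>n. P (n - k)) \<longlonglongrightarrow> A"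
        using P by (simp add: LIMSEQ_offset[of "\<lambda>n. P (n - k)" k A])
      then show "(\<lambda>n. P (n - k) * b k) \<longlonglongrightarrow> A * b k"
        by (intro tendsto_intros)
      show "\<forall>\<^sub>F n in sequentially. P (n - k) * b k = f k n"
        using eventually_gt_at_top[of k] by eventually_elim (simp add: f_def)
    qed
    have "0 \<le> C" using C[of 0] norm_ge_zero order_trans by blast
    then have "norm (f k n) \<le> C * norm (b k)" for k n
      by (auto simp: f_def intro!: order_trans[OF norm_mult_ineq] mult_right_mono C)
    then show "\<forall>\<^sub>F (k, n) in sequentially \<times>\<^sub>F sequentially. norm (f k n) \<le> C * norm (b k)"
      by (intro always_eventually) auto
    show "summable (\<lambda>k. C * norm (b k))" using b by (rule summable_mult)
  qed simp
  then show ?thesis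
    using suminf_mult[OF summable_norm_cancel[OF b], of A] by (simp add: sums_def partial)
qed

section \<open>The binomial series with real exponent, up to the unit circle\<close>

lemma of_real_gbinomial: "of_real (a gchoose n) = (of_real a gchoose n :: 'a :: {real_field})"
  by (simp add: gbinomial_pochhammer flip: pochhammer_of_real)

text \<open>By the Gamma function asymptotics, the quotient \<open>f\<close> of the coefficient by
  \<open>(- 1) ^ n * n powr (- a - 1)\<close> converges, hence is bounded. The index 0 is left out
  because \<open>0 powr _\<close> is 0 while \<open>a gchoose 0\<close> is 1.\<close>

lemma gbinomial_bound:
  fixes a :: real
  obtains K where "\<And>n. n > 0 \<Longrightarrow> \<bar>a gchoose n\<bar> \<le> K * real n powr (- a - 1)"
proof -
  define f where "f = (\<lambda>n. (a gchoose n) / ((- 1) ^ n / exp ((a + 1) * ln (real n))))"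
  have "convergent f"
    unfolding f_def using gbinomial_asymptotic[of a] by (intro convergentI) simp
  then obtain K where K: "\<And>n. norm (f n) \<le> K"
    by (meson Bseq_def convergent_imp_Bseq)
  have "\<bar>a gchoose n\<bar> \<le> K * real n powr (- a - 1)" if "n > 0" for n
  proof -
    have "real n powr (- a - 1) = 1 / exp ((a + 1) * ln (real n))"
      using that by (simp add: powr_def exp_minus[symmetric] inverse_eq_divide[symmetric] algebra_simps)
    then have "\<bar>a gchoose n\<bar> = norm (f n) * real n powr (- a - 1)"
      by (simp add: f_def abs_mult)
    also have "\<dots> \<le> K * real n powr (- a - 1)"
      by (intro mult_right_mono K) simp
    finally show ?thesis .
  qed
  then show thesis using that by blast
qed

lemma summable_abs_gbinomial:
  fixes a :: real
  assumes "a > 0"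
  shows "summable (\<lambda>n. \<bar>a gchoose n\<bar>)"
proof -
  obtain K where K: "\<And>n. n > 0 \<Longrightarrow> \<bar>a gchoose n\<bar> \<le> K * real n powr (- a - 1)"
    using gbinomial_bound by blast
  have "summable (\<lambda>n. K * real n powr (- a - 1))"
    using assms by (intro summable_mult) (simp add: summable_real_powr_iff)
  then show ?thesis
    by (rule summable_comparison_test_ev[rotated])
       (use eventually_gt_at_top[of 0] in \<open>eventually_elim, simp add: K\<close>)
qed

lemma gbinomial_tendsto_0:
  fixes a :: real
  assumes "a > - 1"
  shows "(\<lambda>n. a gchoose n) \<longlonglongrightarrow> 0"
proof -
  obtain K where K: "\<And>n. n > 0 \<Longrightarrow> \<bar>a gchoose n\<bar> \<le> K * real n powr (- a - 1)"
    using gbinomial_bound by blast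
  have "(\<lambda>n. real n powr (- a - 1)) \<longlonglongrightarrow> 0"
    using assms by (intro tendsto_neg_powr filterlim_real_sequentially) auto
  then have lim: "(\<lambda>n. K * real n powr (- a - 1)) \<longlonglongrightarrow> 0"
    using tendsto_mult_right_zero by blast
  show ?thesis
    by (rule Lim_null_comparison[OF _ lim])
       (use eventually_gt_at_top[of 0] in \<open>eventually_elim, simp add: K\<close>)
qed

lemma tendsto_powr_complex_radial:
  fixes T :: complex and a :: real
  assumes "a > 0" "norm T \<le> 1"
  shows "((\<lambda>r. (1 + of_real r * T) powr of_real a) \<longlongrightarrow> (1 + T) powr of_real a) (at_left 1)"
proof (cases "T = - 1")
  case False
  \<comment> \<open>Off \<open>T = - 1\<close>, the disc shifted by 1 misses the branch cut of the
    principal power, so continuity suffices.\<close>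
  have "1 + T \<notin> \<real>\<^sub>\<le>\<^sub>0"
  proof
    assume "1 + T \<in> \<real>\<^sub>\<le>\<^sub>0"
    then have "Re T \<le> - 1" "Im T = 0" by (auto simp: complex_nonpos_Reals_iff)
    moreover have "\<bar>Re T\<bar> \<le> 1" using abs_Re_le_cmod[of T] assms(2) by linarith
    ultimately show False using False by (auto simp: complex_eq_iff)
  qed
  moreover have "((\<lambda>r. 1 + of_real r * T) \<longlongrightarrow> 1 + T) (at_left (1 :: real))"
    by (auto intro!: tendsto_eq_intros)
  ultimately show ?thesis
    by (intro tendsto_powr_complex tendsto_const)
next
  case True
  \<comment> \<open>At the branch point only the modulus \<open>(1 - r) powr a\<close> matters; it
    tends to 0 since \<open>a > 0\<close>, which agrees with the convention that
    \<open>0 powr _\<close> is 0.\<close>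
  have "((\<lambda>r. norm (1 + of_real r * T) powr a) \<longlongrightarrow> 0 powr a) (at_left 1)"
    by (rule tendsto_powr') (use True assms in \<open>auto intro!: tendsto_eq_intros always_eventually\<close>)
  then have "((\<lambda>r. (1 + of_real r * T) powr of_real a) \<longlongrightarrow> 0) (at_left 1)"
    by - (rule tendsto_norm_zero_cancel, simp add: norm_powr_real_powr')
  then show ?thesis
    using True by simp
qed

text \<open>Inside the disc the expansion is known at \<open>r * T\<close> with
  \<open>r < 1\<close>. As \<open>r\<close> tends to 1, the summable majorant
  \<open>\<bar>a gchoose n\<bar>\<close> lets the limit pass through the sum, while the principal
  power converges radially; uniqueness of limits identifies the two.\<close>

lemma gen_binomial_complex_closed_disc:
  fixes T :: complex and a :: real
  assumes "a > 0" "norm T \<le> 1"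
  shows "(\<lambda>n. of_real (a gchoose n) * T ^ n) sums (1 + T) powr of_real a"
proof -
  have bound: "norm (of_real (a gchoose n) * (of_real r * T) ^ n) \<le> \<bar>a gchoose n\<bar>"
    if "0 \<le> r" "r \<le> 1" for r n
  proof -
    have "norm (of_real r * T) ^ n \<le> 1"
      using that assms by (intro power_le_one) (auto simp: norm_mult intro: mult_le_one)
    then show ?thesis
      unfolding norm_mult norm_power norm_of_real by (intro mult_left_le) auto
  qed
  have sm: "summable (\<lambda>n. of_real (a gchoose n) * T ^ n)"
    by (rule summable_comparison_test[OF _ summable_abs_gbinomial[OF assms(1)]])
       (use bound[of 1] in auto)
  have ev: "\<forall>\<^sub>F r in at_left 1. r \<in> {0<..<1 :: real}"
    by (rule eventually_at_left_real) simp
  have lim: "((\<lambda>r. \<Sum>n. of_real (a gchoose n) * (of_real r * T) ^ n)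
          \<longlongrightarrow> (\<Sum>n. of_real (a gchoose n) * T ^ n)) (at_left (1 :: real))"
  proof (rule tannerys_theorem[where M = "\<lambda>n. \<bar>a gchoose n\<bar>", THEN conjunct2, THEN conjunct2])
    show "((\<lambda>r. of_real (a gchoose n) * (of_real r * T) ^ n)
        \<longlongrightarrow> of_real (a gchoose n) * T ^ n) (at_left (1 :: real))" for n
      by (auto intro!: tendsto_eq_intros)
    show "\<forall>\<^sub>F (n, r) in sequentially \<times>\<^sub>F at_left 1.
        norm (of_real (a gchoose n) * (of_real r * T) ^ n) \<le> \<bar>a gchoose n\<bar>"
      unfolding case_prod_unfold
      by (rule eventually_mono[OF eventually_prodI[OF eventually_True ev]]) (auto intro!: bound)
  qed (auto intro: summable_abs_gbinomial assms)
  have "((\<lambda>r. \<Sum>n. of_real (a gchoose n) * (of_real r * T) ^ n)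
          \<longlongrightarrow> (1 + T) powr of_real a) (at_left (1 :: real))"
  proof (rule Lim_transform_eventually[OF tendsto_powr_complex_radial[OF assms]])
    show "\<forall>\<^sub>F r in at_left 1. (1 + of_real r * T) powr of_real a =
        (\<Sum>n. of_real (a gchoose n) * (of_real r * T) ^ n)"
      using ev
    proof eventually_elim
      case (elim r)
      then have r: "0 < r" "r < 1" by auto
      then have "r * norm T \<le> r"
        using assms(2) by (intro mult_left_le) auto
      then have "r * norm T < 1" using r by linarith
      then have "norm (of_real r * T) < 1"
        using r by (simp add: norm_mult)
      from gen_binomial_complex[OF this, of "of_real a"] show ?case
        by (simp add: of_real_gbinomial sums_iff)
    qed
  qed
  then have "(\<Sum>n. of_real (a gchoose n) * T ^ n) = (1 + T) powr of_real a"
    by (rule tendsto_unique[OF trivial_limit_at_left_real lim])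
  then show ?thesis
    using summable_sums[OF sm] by simp
qed

lemma gen_binomial_complex_unit_circle:
  fixes T :: complex and a :: real
  assumes "a > - 1" "norm T = 1" "T \<noteq> - 1"
  shows "(\<lambda>n. of_real (a gchoose n) * T ^ n) sums (1 + T) powr of_real a"
proof -
  have nz: "1 + T \<noteq> 0" using assms(3) by (simp add: add_eq_0_iff)
  \<comment> \<open>Pascal's rule: multiplication by \<open>1 + T\<close> merges neighbouring
    coefficients into those of exponent \<open>a + 1\<close>. The coefficient of
    \<open>T ^ N\<close> receives only its shifted half, so the other half is subtracted; it
    vanishes in the limit because \<open>a > - 1\<close>.\<close>
  have partial: "(1 + T) * (\<Sum>n<N. of_real (a gchoose n) * T ^ n) =
      (\<Sum>n<Suc N. of_real (a + 1 gchoose n) * T ^ n) - of_real (a gchoose N) * T ^ N" for N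
  proof (induction N)
    case (Suc N)
    have "a + 1 gchoose Suc N = (a gchoose N) + (a gchoose Suc N)"
      using gbinomial_Suc_Suc[of a N] by simp
    then show ?case using Suc by (simp add: algebra_simps)
  qed simp
  have "(\<lambda>N. norm (of_real (a gchoose N) * T ^ N)) \<longlonglongrightarrow> 0"
    using gbinomial_tendsto_0[OF assms(1)] assms(2)
    by (simp add: norm_mult norm_power tendsto_rabs_zero_iff)
  then have "(\<lambda>N. of_real (a gchoose N) * T ^ N) \<longlonglongrightarrow> 0"
    by (rule tendsto_norm_zero_cancel)
  moreover have "(\<lambda>N. \<Sum>n<Suc N. of_real (a + 1 gchoose n) * T ^ n)
      \<longlonglongrightarrow> (1 + T) powr of_real (a + 1)"
    using gen_binomial_complex_closed_disc[of "a + 1" T] assms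
    unfolding sums_def by - (rule LIMSEQ_Suc, simp)
  ultimately have "(\<lambda>N. (1 + T) * (\<Sum>n<N. of_real (a gchoose n) * T ^ n))
      \<longlonglongrightarrow> (1 + T) powr of_real (a + 1) - 0"
    unfolding partial by (intro tendsto_diff)
  then have "(\<lambda>N. (1 + T) * (\<Sum>n<N. of_real (a gchoose n) * T ^ n) / (1 + T))
      \<longlonglongrightarrow> (1 + T) powr of_real (a + 1) / (1 + T)"
    using nz by (intro tendsto_divide) auto
  then show ?thesis using nz by (simp add: sums_def powr_add)
qed

text \<open>The series terminates, so \<open>T\<close> may be arbitrary. Exponent 0 is excluded
  because at \<open>T = - 1\<close> the sum is 1 while \<open>0 powr 0\<close> is 0.\<close>

lemma binomial_series_Nats:
  fixes T :: complex and a :: real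
  assumes "a \<in> \<nat>" "a \<noteq> 0"
  shows "(\<lambda>n. of_real (a gchoose n) * T ^ n) sums (1 + T) powr of_real a"
proof -
  obtain m where m: "a = real m" using assms(1) by (elim Nats_cases)
  then have "m \<noteq> 0" using assms(2) by simp
  have "(\<lambda>n. of_real (a gchoose n) * T ^ n) sums (\<Sum>n\<le>m. of_real (a gchoose n) * T ^ n)"
    by (rule sums_finite) (auto simp: m binomial_gbinomial[symmetric])
  also have "(\<Sum>n\<le>m. of_real (a gchoose n) * T ^ n) = (T + 1) ^ m"
    by (simp add: m binomial_gbinomial[symmetric] binomial_ring)
  also have "\<dots> = (1 + T) powr of_real a"
    using powr_nat'[of "1 + T" m] \<open>m \<noteq> 0\<close> m by (simp add: add.commute)
  finally show ?thesis .
qed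

section \<open>The second factor and the coefficient identity\<close>

lemma pochhammer_series:
  fixes w :: complex and a :: real
  assumes "norm w < 1"
  shows "(\<lambda>n. of_real (pochhammer a n / fact n) * w ^ n) sums (1 / (1 - w) powr of_real a)"
    and "summable (\<lambda>n. norm (of_real (pochhammer a n / fact n) * w ^ n))"
proof -
  have sums: "(\<lambda>n. of_real (pochhammer a n / fact n) * v ^ n) sums (1 / (1 - v) powr of_real a)"
    if "norm v < 1" for v :: complex
  proof -
    \<comment> \<open>The sign \<open>(- 1) ^ n\<close> relating the two kinds of coefficient is
      absorbed into \<open>(- v) ^ n\<close>, which gives the binomial series of exponent
      \<open>- a\<close> at \<open>- v\<close>.\<close>
    have "of_real (pochhammer a n / fact n) * v ^ n = (of_real (- a) gchoose n) * (- v) ^ n" for n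
    proof -
      have "(- 1) ^ n * (- v) ^ n = v ^ n" by (simp flip: power_mult_distrib)
      then show ?thesis
        by (simp add: gbinomial_pochhammer mult_ac flip: pochhammer_of_real)
    qed
    then show ?thesis
      using gen_binomial_complex[of "- v" "of_real (- a)"] that
      by (simp add: powr_minus inverse_eq_divide)
  qed
  then show "(\<lambda>n. of_real (pochhammer a n / fact n) * w ^ n) sums (1 / (1 - w) powr of_real a)"
    using assms .
  \<comment> \<open>A power series converging at the larger radius \<open>r\<close> converges
    absolutely at \<open>w\<close>.\<close>
  obtain r where r: "norm w < r" "r < 1" using assms dense by blast
  then have abs: "\<bar>r\<bar> = r"
    using le_less_trans[OF norm_ge_zero r(1)] by simp
  then have "norm (of_real r :: complex) < 1" using r by simp
  from sums_summable[OF sums[OF this]]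
  show "summable (\<lambda>n. norm (of_real (pochhammer a n / fact n) * w ^ n))"
    by (rule powser_insidea) (simp add: r abs)
qed

text \<open>Reversing the rising factorial in the denominator gives \<open>(- 1) ^ l * q\<close>,
  where \<open>q\<close> is also the product of the last \<open>l\<close> factors of
  \<open>pochhammer (1 + \<omega>) n\<close>. It cancels, and the sign with
  \<open>pochhammer (- \<omega>) l / fact l\<close> forms \<open>\<omega> gchoose l\<close>.\<close>

lemma skyburst_coeff:
  fixes \<omega> :: real
  assumes \<omega>: "\<And>k::nat. k \<ge> 1 \<Longrightarrow> \<omega> \<noteq> - real k" and "l \<le> n"
  shows "pochhammer (1 + \<omega>) n / fact n *
      (real (n choose l) * (pochhammer (- \<omega>) l / pochhammer (- real n - \<omega>) l)) =
    (\<omega> gchoose l) * (pochhammer (1 + \<omega>) (n - l) / fact (n - l))"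
proof -
  define q where "q = pochhammer (1 + \<omega> + real (n - l)) l"
  have den: "pochhammer (- real n - \<omega>) l = (- 1) ^ l * q"
  proof -
    have "- real n - \<omega> = - (real n + \<omega>)"
      "real n + \<omega> - real l + 1 = 1 + \<omega> + real (n - l)"
      using \<open>l \<le> n\<close> by (simp_all add: of_nat_diff)
    then show ?thesis
      unfolding q_def by (simp only: pochhammer_minus)
  qed
  moreover have "pochhammer (- real n - \<omega>) l \<noteq> 0"
    using \<omega> \<open>l \<le> n\<close> by (intro skyburst_denominator_nonzero) auto
  ultimately have "q \<noteq> 0" by auto
  have "pochhammer (1 + \<omega>) n = pochhammer (1 + \<omega>) (n - l) * q"
    using pochhammer_product[of "n - l" n "1 + \<omega>"] \<open>l \<le> n\<close> by (simp add: q_def)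
  moreover have "real (n choose l) = fact n / (fact l * fact (n - l))"
    using \<open>l \<le> n\<close> by (rule binomial_fact)
  ultimately show ?thesis
    using \<open>q \<noteq> 0\<close> by (simp add: den gbinomial_pochhammer field_simps)
qed

text \<open>A bound on \<open>z * T\<close> alone does not confine \<open>T\<close>: at
  \<open>z = 0\<close> the series is the binomial series of \<open>(1 + T) powr \<omega>\<close>.
  The last hypothesis describes where that series converges to the principal power.\<close>

theorem theorem2:
  fixes \<omega> :: real and z T :: complex
  assumes "\<omega> \<noteq> 0"
    and "\<And>k::nat. k \<ge> 1 \<Longrightarrow> \<omega> \<noteq> - real k"
    and "norm (z * T) < 1"
    and "norm T < 1 \<or> \<omega> \<in> \<nat> \<or>
         norm T = 1 \<and> (\<omega> > 0 \<or> \<omega> > - 1 \<and> T \<noteq> - 1)"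
  shows "(\<lambda>n. complex_of_real (pochhammer (1 + \<omega>) n / fact n) * poly (skyburst n \<omega>) z * T ^ n)
           sums ((1 + T) powr complex_of_real \<omega> / (1 - z * T) powr complex_of_real (\<omega> + 1))"
proof -
  define a where "a n = complex_of_real (\<omega> gchoose n) * T ^ n" for n
  define b where "b n = complex_of_real (pochhammer (1 + \<omega>) n / fact n) * (z * T) ^ n" for n
  have a: "a sums (1 + T) powr of_real \<omega>"
    using assms(4) gen_binomial_complex[of T "of_real \<omega>"] binomial_series_Nats[of \<omega> T]
      gen_binomial_complex_closed_disc[of \<omega> T] gen_binomial_complex_unit_circle[of \<omega> T] assms(1)
    unfolding a_def by (auto simp: of_real_gbinomial)
  have b: "b sums (1 / (1 - z * T) powr of_real (1 + \<omega>))" "summable (\<lambda>n. norm (b n))"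
    unfolding b_def using pochhammer_series[OF assms(3)] by blast+
  have "complex_of_real (pochhammer (1 + \<omega>) n / fact n) * poly (skyburst n \<omega>) z * T ^ n =
      (\<Sum>l\<le>n. a l * b (n - l))" for n
    unfolding poly_skyburst sum_distrib_left sum_distrib_right
  proof (rule sum.cong[OF refl])
    fix l assume "l \<in> {..n}"
    then have l: "l \<le> n" by simp
    let ?c = "complex_of_real (real (n choose l) *
        (pochhammer (- \<omega>) l / pochhammer (- real n - \<omega>) l))"
    \<comment> \<open>The factor \<open>T ^ l\<close> belongs to \<open>a l\<close>, and
      \<open>T ^ (n - l)\<close> joins \<open>z ^ (n - l)\<close> in
      \<open>b (n - l)\<close>.\<close>
    have T: "T ^ n = T ^ l * T ^ (n - l)" using l by (simp flip: power_add)
    have c: "of_real (pochhammer (1 + \<omega>) n / fact n) * ?c =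
        complex_of_real ((\<omega> gchoose l) * (pochhammer (1 + \<omega>) (n - l) / fact (n - l)))"
      using arg_cong[OF skyburst_coeff[OF assms(2) l], of complex_of_real]
      by (simp only: of_real_mult)
    have "of_real (pochhammer (1 + \<omega>) n / fact n) * (?c * z ^ (n - l)) * T ^ n =
        of_real (pochhammer (1 + \<omega>) n / fact n) * ?c * (z ^ (n - l) * T ^ n)"
      by (simp only: mult.assoc)
    also have "\<dots> = a l * b (n - l)"
      unfolding c unfolding a_def b_def T power_mult_distrib of_real_mult
      by (simp only: mult_ac)
    finally show "of_real (pochhammer (1 + \<omega>) n / fact n) * (?c * z ^ (n - l)) * T ^ n =
        a l * b (n - l)" .
  qed
  then show ?thesis
    using Mertens_sums[OF a b(2)] b(1) by (simp add: sums_iff add.commute)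
qed

end
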